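(* Let $m\ge2$, $n\ge1$, let $\mathcal{A}=(a_{i_1\cdots i_m})\in T_{m,n}$ be a $Z$-tensor and let $\lambda$ be a real eigenvalue of $\mathcal{A}$. Then $$\lambda\in\bigcup_{i=1}^n\left[\sum_{i_2,\dots,i_m=1}^n a_{ii_2\cdots i_m},\ \ a_{ii\cdots i}-\sum_{(i_2,\dots,i_m)\ne(i,\dots,i)}a_{ii_2\cdots i_m}\right].$$
   Context: $[n]=\{1,\dots,n\}$. $T_{m,n}$ is the set of real $m$th order $n$-dimensional tensors $\mathcal{A}=(a_{i_1\cdots i_m})$, $i_1,\dots,i_m\in[n]$. Sums over $(i_2,\dots,i_m)$ range over tuples in $[n]^{m-1}$. $\mathcal{A}$ is a $Z$-tensor if all its off-diagonal entries are non-positive, i.e. $a_{ii_2\cdots i_m}\le 0$ for all $i\in[n]$ and $(i_2,\dots,i_m)\neq(i,\dots,i)$. For $\mathbf{x}\in\mathbb{C}^n$, $\mathcal{A}\mathbf{x}^{m-1}\in\mathbb{C}^n$ has $i$th component $\sum_{i_2,\dots,i_m=1}^n a_{ii_2\cdots i_m}x_{i_2}\cdots x_{i_m}$, and $\mathbf{x}^{[m-1]}=(x_1^{m-1},\dots,x_n^{m-1})^\top$. A number $\lambda\in\mathbb{C}$ is an eigenvalue of $\mathcal{A}$ if there is a nonzero $\mathbf{x}\in\mathbb{C}^n$ with $\mathcal{A}\mathbf{x}^{m-1}=\lambda\mathbf{x}^{[m-1]}$. A real eigenvalue is an eigenvalue $\lambda\in\mathbb{R}$ (its eigenvectors may be complex).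 *)

theory Defs
  imports "HOL-Analysis.Analysis"
begin

text \<open>
  A real tensor of order \<open>m\<close> and dimension \<open>n = CARD('n)\<close> is given by its entries
  \<open>A [i\<^sub>1, \<dots>, i\<^sub>m]\<close>.  The type does not record the order: it is the parameter \<open>m\<close> below, and
  only the values of \<open>A\<close> at lists of length \<open>m\<close> are ever used.
\<close>

type_synonym 'n tensor = "'n list \<Rightarrow> real"

definition tuples :: "nat \<Rightarrow> 'n list set" where
  "tuples k = {js. length js = k}"

lemma finite_tuples [simp]: "finite (tuples k :: ('n::finite) list set)"
  using finite_lists_length_eq[of "UNIV :: 'n set" k] by (simp add: tuples_def)

definition Z_tensor :: "nat \<Rightarrow> ('n::finite) tensor \<Rightarrow> bool" where
  "Z_tensor m A \<longleftrightarrow>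
     (\<forall>i. \<forall>js \<in> tuples (m - 1). js \<noteq> replicate (m - 1) i \<longrightarrow> A (i # js) \<le> 0)"

definition tensor_apply :: "nat \<Rightarrow> ('n::finite) tensor \<Rightarrow> complex ^ 'n \<Rightarrow> complex ^ 'n" where
  "tensor_apply m A x =
     (\<chi> i. \<Sum>js \<in> tuples (m - 1). complex_of_real (A (i # js)) * (\<Prod>j\<leftarrow>js. x $ j))"

definition vec_power :: "complex ^ 'n \<Rightarrow> nat \<Rightarrow> complex ^ 'n" where
  "vec_power x k = (\<chi> i. (x $ i) ^ k)"

definition tensor_eigenvalue :: "nat \<Rightarrow> ('n::finite) tensor \<Rightarrow> complex \<Rightarrow> bool" where
  "tensor_eigenvalue m A \<mu> \<longleftrightarrow>
     (\<exists>x. x \<noteq> 0 \<and> tensor_apply m A x = \<mu> *s vec_power x (m - 1))"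

end

theory Submission
  imports Defs
begin

text \<open>This is Gershgorin's disc argument for tensors. At an index \<open>i\<close> where an
  eigenvector has an entry of largest modulus, the \<open>i\<close>th eigenvalue equation confines
  the eigenvalue to the disc centred at the diagonal entry, with radius the sum of the moduli of the
  other entries of that row (\<open>tensor_gershgorin\<close>). For a Z-tensor those entries are
  non-positive, so the radius is minus their sum, and the real points of the disc form exactly the
  claimed interval.\<close>

lemma norm_prod_list_le:
  fixes f :: "'a \<Rightarrow> 'b::real_normed_field"
  assumes "\<And>j. norm (f j) \<le> r"
  shows "norm (\<Prod>j\<leftarrow>js. f j) \<le> r ^ length js"
  by (induction js) (auto simp: norm_mult intro!: mult_mono assms order_trans[OF norm_ge_zero assms])

text \<open>Dividing the \<open>i\<close>th equation by the power of a dominant coordinate leaves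
  products of ratios of modulus at most 1, so each off-diagonal term is bounded by the modulus of
  its coefficient.\<close>

lemma tensor_gershgorin:
  fixes A :: "('n::finite) tensor"
  assumes "m \<ge> 1" and "tensor_eigenvalue m A \<mu>"
  obtains i where "cmod (\<mu> - A (replicate m i))
    \<le> (\<Sum>js \<in> tuples (m - 1) - {replicate (m - 1) i}. \<bar>A (i # js)\<bar>)"
proof -
  obtain x where "x \<noteq> 0" and eig: "tensor_apply m A x = \<mu> *s vec_power x (m - 1)"
    using assms(2) by (auto simp: tensor_eigenvalue_def)
  define k where "k = m - 1"
  have rep: "replicate m i = i # replicate k i" for i :: 'n
    using assms(1) by (cases m) (auto simp: k_def)
  have "Max (range (\<lambda>j. cmod (x $ j))) \<in> range (\<lambda>j. cmod (x $ j))"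
    by (intro Max_in) auto
  then obtain i where i: "Max (range (\<lambda>j. cmod (x $ j))) = cmod (x $ i)"
    by (rule rangeE)
  have max: "cmod (x $ j) \<le> cmod (x $ i)" for j
    unfolding i[symmetric] by (intro Max_ge) auto
  define r where "r = cmod (x $ i)"
  \<comment> \<open>Positivity of the maximum \<open>r\<close> is what allows \<open>r ^ k\<close>
    to be cancelled at the end.\<close>
  obtain j where "x $ j \<noteq> 0"
    using \<open>x \<noteq> 0\<close> by (auto simp: vec_eq_iff)
  with max[of j] have "r > 0"
    unfolding r_def by (meson order_less_le_trans zero_less_norm_iff)
  let ?T = "tuples k - {replicate k i}"
  have "(\<Sum>js \<in> tuples k. complex_of_real (A (i # js)) * (\<Prod>j\<leftarrow>js. x $ j)) = \<mu> * (x $ i) ^ k"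
    using arg_cong[OF eig, of "\<lambda>v. v $ i"]
    by (simp add: tensor_apply_def vec_power_def k_def)
  moreover have "replicate k i \<in> tuples k"
    by (simp add: tuples_def)
  \<comment> \<open>The diagonal tuple contributes the same monomial \<open>(x $ i) ^ k\<close> as
    the right-hand side, so the two combine.\<close>
  ultimately have "(\<mu> - A (replicate m i)) * (x $ i) ^ k
      = (\<Sum>js \<in> ?T. complex_of_real (A (i # js)) * (\<Prod>j\<leftarrow>js. x $ j))"
    by (simp add: sum_diff1 rep algebra_simps)
  then have "cmod (\<mu> - A (replicate m i)) * r ^ k
      = cmod (\<Sum>js \<in> ?T. complex_of_real (A (i # js)) * (\<Prod>j\<leftarrow>js. x $ j))"
    by (metis norm_mult norm_power r_def)
  also have "\<dots> \<le> (\<Sum>js \<in> ?T. \<bar>A (i # js)\<bar> * r ^ k)"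
    using norm_prod_list_le[of "\<lambda>j. x $ j" r] max
    by (intro sum_norm_le) (auto simp: norm_mult tuples_def r_def intro!: mult_left_mono)
  finally have "cmod (\<mu> - A (replicate m i)) \<le> (\<Sum>js \<in> ?T. \<bar>A (i # js)\<bar>)"
    using \<open>r > 0\<close> by (simp flip: sum_distrib_right)
  then show thesis
    using that by (simp add: k_def)
qed

theorem theorem5:
  fixes A :: "('n::finite) tensor" and m :: nat and \<mu> :: real
  assumes "m \<ge> 2"
    and "Z_tensor m A"
    and "tensor_eigenvalue m A (complex_of_real \<mu>)"
  shows "\<mu> \<in> (\<Union>i::'n.
    {(\<Sum>js \<in> tuples (m - 1). A (i # js)) ..
     A (replicate m i) - (\<Sum>js \<in> tuples (m - 1) - {replicate (m - 1) i}. A (i # js))})"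
proof -
  obtain i where i: "cmod (complex_of_real \<mu> - A (replicate m i))
      \<le> (\<Sum>js \<in> tuples (m - 1) - {replicate (m - 1) i}. \<bar>A (i # js)\<bar>)"
    using tensor_gershgorin[OF _ assms(3)] assms(1) by auto
  let ?S = "\<Sum>js \<in> tuples (m - 1) - {replicate (m - 1) i}. A (i # js)"
  \<comment> \<open>The sign condition enters here: each off-diagonal entry has modulus equal to its
    negative.\<close>
  have "(\<Sum>js \<in> tuples (m - 1) - {replicate (m - 1) i}. \<bar>A (i # js)\<bar>) = - ?S"
    using assms(2) unfolding sum_negf[symmetric]
    by (intro sum.cong) (auto simp: Z_tensor_def)
  with i have bound: "\<bar>\<mu> - A (replicate m i)\<bar> \<le> - ?S"
    by (simp flip: of_real_diff)
  have rep: "replicate m i = i # replicate (m - 1) i"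
    using assms(1) by (cases m) auto
  \<comment> \<open>Centre minus radius is the full row sum, the lower endpoint.\<close>
  have "(\<Sum>js \<in> tuples (m - 1). A (i # js)) = A (replicate m i) + ?S"
    unfolding rep by (intro sum.remove) (auto simp: tuples_def finite_tuples[unfolded tuples_def])
  with bound show ?thesis
    by (intro UN_I[of i]) (auto simp: abs_le_iff)
qed

end
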